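(* Let $n\ge 3$ and let $\alpha_3,\dots,\alpha_n,\theta\in\mathbb{C}$ be such that $\theta\ne\alpha_n$ and there exists $k$ with $3\le k\le n$ and $\alpha_k\neq 0$. Then the filiform Leibniz algebra $F_1(\alpha_3,\alpha_4,\dots,\alpha_n,\theta)$ is characteristically nilpotent.
   Context: A Leibniz algebra is a vector space with a bilinear bracket satisfying $[[x,y],z]=[[x,z],y]+[x,[y,z]]$. A derivation of a Leibniz algebra $L$ is a linear map $d:L\to L$ with $d([x,y])=[d(x),y]+[x,d(y)]$. With $L^1=L$, $L^{k+1}=[L^k,L]$, $L$ is nilpotent if $L^s=0$ for some $s$. A nilpotent Leibniz algebra is called characteristically nilpotent if all its derivations are nilpotent linear maps. For complex parameters, $F_1(\alpha_3,\dots,\alpha_n,\theta)$ denotes the $(n+1)$-dimensional complex Leibniz algebra with basis $\{e_0,e_1,\dots,e_n\}$ and products $[e_0,e_0]=e_2$; $[e_i,e_0]=e_{i+1}$ for $1\le i\le n-1$; $[e_0,e_1]=\sum_{k=3}^{n-1}\alpha_ke_k+\theta e_n$; $[e_i,e_1]=\sum_{k=i+2}^n\alpha_{k+1-i}e_k$ for $1\le i\le n-2$; all other products of basis elements are zero. *)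

theory Defs
  imports Complex_Main
begin

locale bilinear_algebra = vector_space scale
  for scale :: "'k::field \<Rightarrow> 'a::ab_group_add \<Rightarrow> 'a" +
  fixes bracket :: "'a \<Rightarrow> 'a \<Rightarrow> 'a"
  assumes linear_right: "Vector_Spaces.linear scale scale (\<lambda>y. bracket x y)"
    and linear_left: "Vector_Spaces.linear scale scale (\<lambda>x. bracket x y)"
begin

definition derivation :: "('a \<Rightarrow> 'a) \<Rightarrow> bool" where
  "derivation d \<longleftrightarrow> Vector_Spaces.linear scale scale d \<and>
     (\<forall>x y. d (bracket x y) = bracket (d x) y + bracket x (d y))"

text \<open>The index is shifted by one: \<open>lower_central k\<close> is $L^{k+1}$, so that
  \<open>lower_central 0\<close> is $L^1 = L$.  As usual, $[L^k, L]$ is the linear span of the brackets.\<close>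

primrec lower_central :: "nat \<Rightarrow> 'a set" where
  "lower_central 0 = UNIV"
| "lower_central (Suc k) = span {bracket x y |x y. x \<in> lower_central k}"

definition nilpotent :: bool where
  "nilpotent \<longleftrightarrow> (\<exists>s. lower_central s = {0})"

end

locale leibniz_algebra = bilinear_algebra +
  assumes leibniz: "bracket (bracket x y) z = bracket (bracket x z) y + bracket x (bracket y z)"

definition characteristically_nilpotent ::
  "('k::field \<Rightarrow> 'a::ab_group_add \<Rightarrow> 'a) \<Rightarrow> ('a \<Rightarrow> 'a \<Rightarrow> 'a) \<Rightarrow> bool" where
  "characteristically_nilpotent scale bracket \<longleftrightarrow>
     leibniz_algebra scale bracket \<and>
     bilinear_algebra.nilpotent scale bracket \<and>
     (\<forall>d. bilinear_algebra.derivation scale bracket d \<longrightarrow> (\<exists>m. d ^^ m = (\<lambda>_. 0)))"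

text \<open>The product $[e_i, e_j]$ of two basis elements of $F_1(\alpha_3,\dots,\alpha_n,\theta)$;
  only the values \<open>\<alpha> k\<close> with $3 \le k \le n$ are used.\<close>

definition F1_product ::
  "(complex \<Rightarrow> 'a::ab_group_add \<Rightarrow> 'a) \<Rightarrow> (nat \<Rightarrow> 'a) \<Rightarrow> nat \<Rightarrow> (nat \<Rightarrow> complex) \<Rightarrow> complex
     \<Rightarrow> nat \<Rightarrow> nat \<Rightarrow> 'a" where
  "F1_product scale e n \<alpha> \<theta> i j =
     (if i = 0 \<and> j = 0 then e 2
      else if 1 \<le> i \<and> i \<le> n - 1 \<and> j = 0 then e (i + 1)
      else if i = 0 \<and> j = 1 then (\<Sum>k = 3..n - 1. scale (\<alpha> k) (e k)) + scale \<theta> (e n)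
      else if 1 \<le> i \<and> i \<le> n - 2 \<and> j = 1 then (\<Sum>k = i + 2..n. scale (\<alpha> (k + 1 - i)) (e k))
      else 0)"

text \<open>The algebra \<open>(scale, bracket)\<close> on the type \<open>'a\<close> is
  $F_1(\alpha_3,\dots,\alpha_n,\theta)$ with respect to the basis $e_0,\dots,e_n$ of \<open>'a\<close>.
  The Leibniz identity is not assumed, as it follows from the multiplication table.\<close>

locale F1_algebra = bilinear_algebra scale bracket
  for scale :: "complex \<Rightarrow> 'a::ab_group_add \<Rightarrow> 'a" and bracket :: "'a \<Rightarrow> 'a \<Rightarrow> 'a" +
  fixes e :: "nat \<Rightarrow> 'a" and n :: nat and \<alpha> :: "nat \<Rightarrow> complex" and \<theta> :: complex
  assumes basis_distinct: "inj_on e {0..n}"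
    and basis_independent: "independent (e ` {0..n})"
    and basis_span: "span (e ` {0..n}) = UNIV"
    and bracket_basis:
      "i \<le> n \<Longrightarrow> j \<le> n \<Longrightarrow> bracket (e i) (e j) = F1_product scale e n \<alpha> \<theta> i j"

text \<open>Every space with a basis $e_0,\dots,e_n$ carries such an algebra.\<close>

lemma F1_algebra_exists:
  fixes scale :: "complex \<Rightarrow> 'a::ab_group_add \<Rightarrow> 'a"
  assumes "vector_space scale" and inj: "inj_on e {0..n}"
    and ind: "\<not> module.dependent scale (e ` {0..n})"
    and spn: "module.span scale (e ` {0..n}) = UNIV"
  shows "\<exists>bracket. F1_algebra scale bracket e n \<alpha> \<theta>"
proof -
  interpret vector_space scale by fact
  define r where "r x i = representation (e ` {0..n}) x (e i)" for x i
  have r_add: "r (x + y) i = r x i + r y i" for x y i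
    unfolding r_def by (simp add: representation_add ind spn)
  have r_scale: "r (scale c x) i = c * r x i" for c x i
    unfolding r_def by (simp add: representation_scale ind spn)
  have r_basis: "r (e i) j = (if j = i then 1 else 0)" if "i \<le> n" "j \<le> n" for i j
    using that inj unfolding r_def
    by (subst representation_basis[OF ind]) (auto simp: inj_on_def)
  define p where "p i j = F1_product scale e n \<alpha> \<theta> i j" for i j
  define b where "b x y = (\<Sum>i\<le>n. \<Sum>j\<le>n. scale (r x i * r y j) (p i j))" for x y
  have lin: "Vector_Spaces.linear scale scale f"
    if "\<And>x y. f (x + y) = f x + f y" "\<And>c x. f (scale c x) = scale c (f x)" for f
    using that vector_space_axioms
    by (simp add: Vector_Spaces.linear_def module_hom_def module_hom_axioms_def
        vector_space_def module_def)
  have "Vector_Spaces.linear scale scale (\<lambda>y. b x y)" for x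
    by (rule lin)
      (simp_all add: b_def r_add r_scale distrib_left scale_left_distrib sum.distrib
        scale_sum_right mult.left_commute)
  moreover have "Vector_Spaces.linear scale scale (\<lambda>x. b x y)" for y
    by (rule lin)
      (simp_all add: b_def r_add r_scale distrib_right scale_left_distrib sum.distrib
        scale_sum_right mult.assoc)
  moreover have "b (e i) (e j) = p i j" if ij: "i \<le> n" "j \<le> n" for i j
  proof -
    have "b (e i) (e j) =
        (\<Sum>i'\<le>n. \<Sum>j'\<le>n. if j' = j then if i' = i then p i j else 0 else 0)"
      unfolding b_def using ij by (intro sum.cong refl) (simp add: r_basis)
    also have "\<dots> = p i j" using ij by simp
    finally show ?thesis .
  qed
  ultimately have "F1_algebra scale b e n \<alpha> \<theta>"
    using inj ind spn
    by (simp add: F1_algebra_def F1_algebra_axioms_def bilinear_algebra_def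
        bilinear_algebra_axioms_def vector_space_axioms p_def)
  then show ?thesis by blast
qed

end

theory Submission
  imports Defs
begin

text \<open>
  Write $N$ and $M$ for the right multiplications by $e_0$ and $e_1$.  Every bracket
  $[x, y]$ is a combination of $N x$ and $M x$, whose coefficients are the first two coordinates
  of $y$, so the Leibniz identity amounts to $N M = M N$.  Let $d$ be a derivation with
  $d(e_0) = a_0 e_0 + a_1 e_1 + \dots$ and $d(e_1) = b_0 e_0 + b_1 e_1 + \dots$.  On the span of
  $e_2, \dots, e_n$ it is triangular with eigenvalues $b_0 + b_1 + (i - 1) a_0$, and it suffices
  to show $a_0 = a_1 = b_0 = b_1 = 0$.  The $e_2$-coordinate of $d[e_1, e_1]$ gives $b_0 = 0$.
  For $f = e_0 - e_1$, the identity $[f, e_0] = 0$ gives $a_0 + a_1 = b_0 + b_1$, and then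
  $[f, e_1] = (\theta - \alpha_n) e_n \neq 0$ gives $(n - 2) a_0 = 0$.  Finally, for the first
  $\alpha_k \neq 0$ the $e_k$-coordinate of $d[e_1, e_1]$ gives $b_1 = 0$.
\<close>

section \<open>Coordinates with respect to the basis\<close>

context F1_algebra
begin

text \<open>Beyond \<open>n\<close> the vectors \<open>e i\<close> are arbitrary and may repeat a
  basis vector, so the coordinate is set to 0 there.\<close>

definition coord :: "'a \<Rightarrow> nat \<Rightarrow> complex" where
  "coord x i = (if i \<le> n then representation (e ` {0..n}) x (e i) else 0)"

lemma coord_add: "coord (x + y) i = coord x i + coord y i"
  by (simp add: coord_def representation_add basis_independent basis_span)

lemma coord_diff: "coord (x - y) i = coord x i - coord y i"
  by (simp add: coord_def representation_diff basis_independent basis_span)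

lemma coord_scale: "coord (scale c x) i = c * coord x i"
  by (simp add: coord_def representation_scale basis_independent basis_span)

lemma coord_zero: "coord 0 i = 0"
  by (simp add: coord_def representation_zero)

lemma coord_sum: "coord (\<Sum>j\<in>A. f j) i = (\<Sum>j\<in>A. coord (f j) i)"
  by (induction A rule: infinite_finite_induct) (simp_all add: coord_zero coord_add)

lemma coord_basis:
  assumes "i \<le> n"
  shows "coord (e i) k = (if k = i then 1 else 0)"
proof -
  have "representation (e ` {0..n}) (e i) = (\<lambda>v. if v = e i then 1 else 0)"
    using assms by (intro representation_basis[OF basis_independent]) simp
  then show ?thesis
    using assms basis_distinct by (auto simp: coord_def inj_on_def)
qed

lemma coord_expansion: "x = (\<Sum>i\<le>n. scale (coord x i) (e i))"
proof -
  have "(\<Sum>i\<le>n. scale (coord x i) (e i)) =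
      (\<Sum>i\<in>{0..n}. scale (representation (e ` {0..n}) x (e i)) (e i))"
    by (rule sum.cong) (auto simp: coord_def)
  also have "\<dots> = (\<Sum>b\<in>e ` {0..n}. scale (representation (e ` {0..n}) x b) b)"
    by (simp add: sum.reindex[OF basis_distinct])
  also have "\<dots> = x"
    by (rule sum_representation_eq[OF basis_independent]) (simp_all add: basis_span)
  finally show ?thesis by simp
qed

lemma coord_eqI:
  assumes "\<And>i. i \<le> n \<Longrightarrow> coord x i = coord y i"
  shows "x = y"
proof -
  have "(\<Sum>i\<le>n. scale (coord x i) (e i)) = (\<Sum>i\<le>n. scale (coord y i) (e i))"
    by (rule sum.cong) (simp_all add: assms)
  then show ?thesis
    by (metis coord_expansion)
qed

lemma linear_expansion:
  assumes "Vector_Spaces.linear scale scale f"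
  shows "f x = (\<Sum>i\<le>n. scale (coord x i) (f (e i)))"
proof -
  interpret f: Vector_Spaces.linear scale scale f by fact
  have "f x = f (\<Sum>i\<le>n. scale (coord x i) (e i))"
    by (simp flip: coord_expansion)
  then show ?thesis
    by (simp add: f.sum f.scale)
qed

lemma coord_linear:
  assumes "Vector_Spaces.linear scale scale f"
  shows "coord (f x) k = (\<Sum>i\<le>n. coord x i * coord (f (e i)) k)"
  by (subst linear_expansion[OF assms]) (simp add: coord_sum coord_scale)

section \<open>Right multiplication by \<open>e 0\<close> and \<open>e 1\<close> in
  coordinates\<close>

lemma bracket_diff_left: "bracket (x - y) z = bracket x z - bracket y z"
  and bracket_add_left: "bracket (x + y) z = bracket x z + bracket y z"
  and bracket_scale_left: "bracket (scale c x) z = scale c (bracket x z)"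
proof -
  interpret l: Vector_Spaces.linear scale scale "\<lambda>x. bracket x z"
    by (rule linear_left)
  show "bracket (x - y) z = bracket x z - bracket y z"
    and "bracket (x + y) z = bracket x z + bracket y z"
    and "bracket (scale c x) z = scale c (bracket x z)"
    by (rule l.diff l.add l.scale)+
qed

text \<open>Every product with right factor \<open>e j\<close>, $j >= 2$, vanishes, so only the
  first two coordinates of \<open>y\<close> act.\<close>

lemma bracket_eq:
  assumes "3 \<le> n"
  shows "bracket x y = scale (coord y 0) (bracket x (e 0)) + scale (coord y 1) (bracket x (e 1))"
proof -
  have *: "bracket x (e j) = 0" if "j \<le> n" "2 \<le> j" for j
  proof -
    have "bracket (e i) (e j) = 0" if "i \<le> n" for i
      using that \<open>j \<le> n\<close> \<open>2 \<le> j\<close> by (simp add: bracket_basis F1_product_def)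
    then show ?thesis
      by (subst linear_expansion[OF linear_left]) simp
  qed
  have "{..n} = insert 0 (insert 1 {2..n})"
    using assms by auto
  then show ?thesis
    by (subst linear_expansion[OF linear_right]) (simp add: *)
qed

text \<open>Right multiplication by \<open>e 0\<close> shifts \<open>e i\<close> to
  \<open>e (i + 1)\<close> for $1 <= i < n$ and kills \<open>e n\<close>. Both \<open>e 0\<close>
  and \<open>e 1\<close> go to \<open>e 2\<close>, hence the extra term at
  \<open>k = 2\<close>.\<close>

lemma coord_bracket_e0:
  assumes "3 \<le> n"
  shows "coord (bracket x (e 0)) k =
    (if k = 2 then coord x 0 else 0) + (if 2 \<le> k \<and> k \<le> n then coord x (k - 1) else 0)"
proof -
  have 0: "coord (bracket (e 0) (e 0)) k = (if k = 2 then 1 else 0)"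
    using assms by (simp add: bracket_basis F1_product_def coord_basis)
  have i: "coord x i * coord (bracket (e i) (e 0)) k =
      (if i = k - 1 then if 2 \<le> k \<and> k \<le> n then coord x i else 0 else 0)"
    if "i \<in> {1..n}" for i
    using that assms
    by (cases "i = n") (auto simp: bracket_basis F1_product_def coord_basis coord_zero)
  have "{..n} = insert 0 {1..n}" by auto
  then have "coord (bracket x (e 0)) k = coord x 0 * coord (bracket (e 0) (e 0)) k +
      (\<Sum>i = 1..n. coord x i * coord (bracket (e i) (e 0)) k)"
    by (subst coord_linear[OF linear_left]) simp
  also have "(\<Sum>i = 1..n. coord x i * coord (bracket (e i) (e 0)) k) =
      (if 2 \<le> k \<and> k \<le> n then coord x (k - 1) else 0)"
    by (subst sum.cong[OF refl i]) (auto simp: sum.delta)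
  finally show ?thesis
    by (simp add: 0)
qed

text \<open>The condition $i + 2 <= k$ of the table becomes \<open>i < k - 1\<close>. The bound
  \<open>k \<le> n\<close> matters: beyond it the left side is 0, while the sum need not be.\<close>

lemma coord_bracket_e1:
  assumes "3 \<le> n" "k \<le> n"
  shows "coord (bracket x (e 1)) k =
    (if 3 \<le> k then (if k < n then \<alpha> k else \<theta>) * coord x 0 else 0) +
    (\<Sum>i = 1..<k - 1. \<alpha> (Suc k - i) * coord x i)"
proof -
  have 0: "coord (bracket (e 0) (e 1)) k = (if 3 \<le> k then if k < n then \<alpha> k else \<theta> else 0)"
  proof -
    have "(\<Sum>j = 3..n - 1. \<alpha> j * coord (e j) k) = (\<Sum>j = 3..n - 1. if k = j then \<alpha> j else 0)"
      by (rule sum.cong) (auto simp: coord_basis)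
    then have "coord (bracket (e 0) (e 1)) k =
        (\<Sum>j = 3..n - 1. if k = j then \<alpha> j else 0) + \<theta> * (if k = n then 1 else 0)"
      using assms
      by (simp add: bracket_basis F1_product_def coord_add coord_sum coord_scale coord_basis)
    then show ?thesis
      using assms by (auto simp: sum.delta)
  qed
  have i: "coord x i * coord (bracket (e i) (e 1)) k =
      (if i \<in> {1..<k - 1} then \<alpha> (Suc k - i) * coord x i else 0)"
    if "i \<in> {1..n}" for i
  proof (cases "i \<le> n - 2")
    case True
    have "coord (bracket (e i) (e 1)) k = (\<Sum>j = i + 2..n. if k = j then \<alpha> (Suc j - i) else 0)"
      using that assms True by (simp add: bracket_basis F1_product_def coord_sum coord_scale
          coord_basis if_distrib cong: if_cong)
    then show ?thesis
      using that assms by (auto simp: sum.delta)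
  next
    case False
    then show ?thesis
      using that assms by (auto simp: bracket_basis F1_product_def coord_zero)
  qed
  have "{..n} = insert 0 {1..n}" by auto
  then have "coord (bracket x (e 1)) k = coord x 0 * coord (bracket (e 0) (e 1)) k +
      (\<Sum>i = 1..n. coord x i * coord (bracket (e i) (e 1)) k)"
    by (subst coord_linear[OF linear_left]) simp
  also have "(\<Sum>i = 1..n. coord x i * coord (bracket (e i) (e 1)) k) =
      (\<Sum>i\<in>{1..n}. if i \<in> {1..<k - 1} then \<alpha> (Suc k - i) * coord x i else 0)"
    by (intro sum.cong refl i)
  also have "\<dots> = (\<Sum>i\<in>{1..n} \<inter> {1..<k - 1}. \<alpha> (Suc k - i) * coord x i)"
    by (rule sum.inter_restrict[symmetric]) simp
  also have "{1..n} \<inter> {1..<k - 1} = {1..<k - 1}"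
    using assms by auto
  finally show ?thesis
    by (simp add: 0 del: One_nat_def)
qed

end

section \<open>The Leibniz identity and nilpotency of the algebra\<close>

locale F1_algebra_ge3 = F1_algebra +
  assumes n_ge_3: "3 \<le> n"
begin

abbreviation N where "N x \<equiv> bracket x (e 0)"
abbreviation M where "M x \<equiv> bracket x (e 1)"

lemmas coord_N = coord_bracket_e0[OF n_ge_3]
lemmas coord_M = coord_bracket_e1[OF n_ge_3, unfolded One_nat_def]
lemmas coord_bracket = arg_cong[OF bracket_eq[OF n_ge_3], of "\<lambda>v. coord v k" for k,
    unfolded coord_add coord_scale One_nat_def]

text \<open>The decreasing filtration by the spans of $e_j, ..., e_n$. Nilpotency, of the algebra
  and later of derivations, follows by showing that a map raises the index \<open>j\<close>.\<close>

definition F :: "nat \<Rightarrow> 'a set" where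
  "F j = {x. \<forall>i<j. coord x i = 0}"

lemma F_eq_zero: "F (Suc n) = {0}"
  unfolding F_def
  using coord_eqI[of _ 0] by (auto simp: coord_zero less_Suc_eq_le)

text \<open>On the span of $e_1, ..., e_n$, \<open>M\<close> is the polynomial $sum_m \<alpha>_m
  N^{m-1}$ in \<open>N\<close>. For \<open>e 0\<close>: \<open>N\<close> agrees on
  \<open>e 0\<close> and \<open>e 1\<close>, and \<open>M (e 0)\<close>, \<open>M (e 1)\<close>
  differ by a multiple of \<open>e n\<close>, which \<open>N\<close> kills.\<close>

lemma N_M_commute: "N (M x) = M (N x)"
proof (rule coord_eqI)
  fix k assume k: "k \<le> n"
  \<comment> \<open>Coordinates up to 3 vanish on both sides; the others are compared after an index
    shift.\<close>
  consider "k \<le> 3" | l where "k = Suc l" "3 \<le> l"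
    by (metis Suc_le_D not_less_eq_eq numeral_3_eq_3)
  then show "coord (N (M x)) k = coord (M (N x)) k"
  proof cases
    case 1
    then show ?thesis
      using k n_ge_3 by (auto simp: coord_N coord_M)
  next
    case 2
    have "(\<Sum>i = 1..<k - 1. \<alpha> (Suc k - i) * coord (N x) i) =
        (\<Sum>i = 2..<k - 1. \<alpha> (Suc k - i) * coord (N x) i)"
      by (rule sum.mono_neutral_right) (auto simp: coord_N)
    also have "\<dots> = (\<Sum>i = 1..<l - 1. \<alpha> (Suc l - i) * coord (N x) (Suc i))"
      by (rule sum.reindex_bij_witness[where i = Suc and j = "\<lambda>i. i - 1"])
        (use 2 in \<open>auto simp: Suc_diff_le\<close>)
    \<comment> \<open>The term \<open>i = 1\<close> contains $(N x)_2 = x_0 + x_1$. Its $x_0$ part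
      is the contribution of \<open>e 0\<close> to coordinate \<open>l\<close> of
      \<open>M x\<close>, with coefficient \<open>\<alpha> l\<close> and not \<open>\<theta>\<close>
      because \<open>l < n\<close>.\<close>
    also have "\<dots> = \<alpha> l * coord x 0 + (\<Sum>i = 1..<l - 1. \<alpha> (Suc l - i) * coord x i)"
    proof -
      have "{1..<l - 1} = insert 1 {2..<l - 1}"
        using 2 by auto
      moreover have "(\<Sum>i = 2..<l - 1. \<alpha> (Suc l - i) * coord (N x) (Suc i)) =
          (\<Sum>i = 2..<l - 1. \<alpha> (Suc l - i) * coord x i)"
        using k 2 by (intro sum.cong) (auto simp: coord_N)
      ultimately show ?thesis
        using k 2 by (simp add: coord_N algebra_simps)
    qed
    finally show ?thesis
      using k 2 by (simp add: coord_N coord_M)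
  qed
qed

lemma leibniz_algebra: "leibniz_algebra scale bracket"
proof
  fix x y z
  \<comment> \<open>Brackets have no \<open>e 0\<close> or \<open>e 1\<close> part, so right
    multiplication by them is zero. The identity reduces to commuting right multiplications.\<close>
  have "coord (bracket y z) 0 = 0" "coord (bracket y z) 1 = 0"
    using n_ge_3 by (subst coord_bracket, simp add: coord_N coord_M)+
  then have "bracket x (bracket y z) = 0"
    by (simp add: bracket_eq[OF n_ge_3, of x "bracket y z"])
  moreover have "bracket (bracket x y) z = bracket (bracket x z) y"
  proof -
    show ?thesis
      unfolding bracket_eq[OF n_ge_3, of _ y] bracket_eq[OF n_ge_3, of _ z]
        bracket_add_left bracket_scale_left N_M_commute scale_right_distrib scale_scale
      by (simp add: mult.commute add_ac)
  qed
  ultimately show "bracket (bracket x y) z = bracket (bracket x z) y + bracket x (bracket y z)"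
    by simp
qed

text \<open>Coordinate \<open>k\<close> of \<open>N x\<close> and of \<open>M x\<close> involves
  only coordinates of \<open>x\<close> of index below \<open>k\<close>.\<close>

lemma bracket_in_F:
  assumes "x \<in> F j"
  shows "bracket x y \<in> F (Suc j)"
proof -
  have "coord (bracket x y) k = 0" if "k < Suc j" for k
  proof (cases "k \<le> n")
    case True
    moreover have "coord x i = 0" if "i < k" for i
      using assms \<open>k < Suc j\<close> that by (simp add: F_def)
    moreover from this have "(\<Sum>i = Suc 0..<k - Suc 0. \<alpha> (Suc k - i) * coord x i) = 0"
      by (intro sum.neutral) auto
    ultimately show ?thesis
      by (subst coord_bracket) (simp add: coord_N coord_M)
  qed (simp add: coord_def)
  then show ?thesis
    by (simp add: F_def)
qed

lemma subspace_F: "subspace (F j)"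
  by (simp add: subspace_def F_def coord_zero coord_add coord_scale)

lemma F_mono: "i \<le> j \<Longrightarrow> F j \<subseteq> F i"
  by (auto simp: F_def)

lemma lower_central_subset_F: "lower_central k \<subseteq> F k"
proof (induction k)
  case 0
  then show ?case by (simp add: F_def)
next
  case (Suc k)
  then have "{bracket x y |x y. x \<in> lower_central k} \<subseteq> F (Suc k)"
    using bracket_in_F by blast
  then show ?case
    using span_minimal subspace_F by simp
qed

lemma nilpotent: nilpotent
proof -
  have "0 \<in> lower_central (Suc n)"
    by (simp add: span_zero)
  then have "lower_central (Suc n) = {0}"
    using lower_central_subset_F[of "Suc n"] unfolding F_eq_zero by blast
  then show ?thesis
    unfolding nilpotent_def by blast
qed

section \<open>Right multiplications on basis vectors\<close>

lemma coord_N_basis [unfolded One_nat_def]: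
  assumes "1 \<le> i" "i \<le> n"
  shows "coord (N (e i)) k = (if k = Suc i \<and> k \<le> n then 1 else 0)"
  using assms by (auto simp: coord_N coord_basis)

lemma coord_M_basis [unfolded One_nat_def]:
  assumes "1 \<le> i" "i \<le> n" "k \<le> n"
  shows "coord (M (e i)) k = (if i + 2 \<le> k then \<alpha> (Suc k - i) else 0)"
proof -
  have "(\<Sum>j = Suc 0..<k - Suc 0. \<alpha> (Suc k - j) * coord (e i) j) =
      (\<Sum>j = Suc 0..<k - Suc 0. if i = j then \<alpha> (Suc k - j) else 0)"
    using assms by (intro sum.cong) (auto simp: coord_basis)
  then show ?thesis
    using assms by (auto simp: coord_M coord_basis)
qed

lemma coord_M_e0 [unfolded One_nat_def]:
  assumes "k \<le> n"
  shows "coord (M (e 0)) k = (if 3 \<le> k then if k < n then \<alpha> k else \<theta> else 0)"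
proof -
  have "(\<Sum>j = Suc 0..<k - Suc 0. \<alpha> (Suc k - j) * coord (e 0) j) = 0"
    by (intro sum.neutral) (auto simp: coord_basis)
  then show ?thesis
    using assms by (simp add: coord_M coord_basis)
qed

text \<open>Both sides are \<open>e 2\<close>. Applying a derivation to this equation relates its
  values on \<open>e 0\<close> and \<open>e 1\<close>.\<close>

lemma N_e0: "N (e 0) = N (e 1)"
  using n_ge_3 by (auto simp: bracket_basis F1_product_def numeral_2_eq_2)

lemma N_basis:
  assumes "1 \<le> i" "i < n"
  shows "N (e i) = e (Suc i)"
  by (rule coord_eqI) (use assms in \<open>auto simp: coord_N_basis coord_basis\<close>)

text \<open>Here $[e_1, e_1] = \<alpha>_3 e_3 + ... + \<alpha>_n e_n$. This serves for
  \<open>k = 3\<close>, where nothing has to vanish, and for the first nonzero parameter.\<close>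

lemma M_e1_in_F:
  assumes "3 \<le> k" "k \<le> n" "\<And>i. 3 \<le> i \<Longrightarrow> i < k \<Longrightarrow> \<alpha> i = 0"
  shows "M (e 1) \<in> F k"
  using assms n_ge_3 by (auto simp: F_def coord_M_basis)

section \<open>Triangular form of a derivation and its first coefficients\<close>

context
  fixes d
  assumes d: "derivation d"
begin

lemma linear_d: "Vector_Spaces.linear scale scale d"
  using d by (simp add: derivation_def)

lemma d_bracket: "d (bracket x y) = bracket (d x) y + bracket x (d y)"
  using d by (simp add: derivation_def)

lemma coord_d: "coord (d x) k = (\<Sum>i\<le>n. coord x i * coord (d (e i)) k)"
  by (rule coord_linear[OF linear_d])

definition eigenvalue :: "nat \<Rightarrow> complex" where
  "eigenvalue i = coord (d (e 1)) 0 + coord (d (e 1)) 1 + (of_nat i - 1) * coord (d (e 0)) 0"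

text \<open>Induction along $e_{i+1} = N e_i$: in $d e_{i+1} = N (d e_i) + [e_i, d e_0]$ the first
  term shifts the leading coefficient and the second adds $a_0$, as $M e_i$ starts only at
  $e_{i+2}$. At the start, $N (d e_1)$ supplies $b_0 + b_1$.\<close>

lemma coord_d_basis:
  assumes "2 \<le> i" "i \<le> n" "k \<le> i"
  shows "coord (d (e i)) k = (if k = i then eigenvalue i else 0)"
  using assms
proof (induction i arbitrary: k rule: nat_induct_at_least)
  case base
  have "d (e 2) = N (d (e 1)) + bracket (e 1) (d (e 0))"
    using N_basis[of 1] n_ge_3 by (simp add: numeral_2_eq_2 flip: d_bracket)
  moreover have "coord (bracket (e 1) (d (e 0))) k = (if k = 2 then coord (d (e 0)) 0 else 0)"
    using base n_ge_3 by (subst coord_bracket) (simp add: coord_N_basis coord_M_basis)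
  ultimately show ?case
    using base n_ge_3 by (auto simp: coord_add coord_N eigenvalue_def)
next
  case (Suc i)
  have "d (e (Suc i)) = N (d (e i)) + bracket (e i) (d (e 0))"
    using N_basis[of i] Suc.prems Suc.hyps by (simp flip: d_bracket)
  moreover have "coord (bracket (e i) (d (e 0))) k = (if k = Suc i then coord (d (e 0)) 0 else 0)"
    using Suc.prems Suc.hyps by (subst coord_bracket) (simp add: coord_N_basis coord_M_basis)
  moreover have "coord (N (d (e i))) k = (if k = Suc i then eigenvalue i else 0)"
    using Suc.prems Suc.hyps by (auto simp: coord_N Suc.IH)
  ultimately show ?case
    by (simp add: coord_add eigenvalue_def algebra_simps)
qed

text \<open>Only the diagonal term survives: for \<open>i < k\<close> the coordinate of
  \<open>x\<close> vanishes, for \<open>i > k\<close> that of \<open>d (e i)\<close>.\<close>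

lemma coord_d_F:
  assumes "x \<in> F k" "2 \<le> k" "k \<le> n"
  shows "coord (d x) k = eigenvalue k * coord x k"
proof -
  have "coord x i * coord (d (e i)) k = (if i = k then eigenvalue k * coord x k else 0)"
    if "i \<le> n" for i
    using assms that by (cases i k rule: linorder_cases) (auto simp: F_def coord_d_basis)
  then have "coord (d x) k = (\<Sum>i\<le>n. if i = k then eigenvalue k * coord x k else 0)"
    unfolding coord_d[of x] by (intro sum.cong) auto
  then show ?thesis
    using assms by simp
qed

lemma derivation_coeffs_relation [unfolded One_nat_def]:
  "coord (d (e 0)) 0 + coord (d (e 0)) 1 = coord (d (e 1)) 0 + coord (d (e 1)) 1"
  and derivation_diff_coord:
  "2 \<le> i \<Longrightarrow> i \<le> n - 2 \<Longrightarrow> coord (d (e 0)) i = coord (d (e 1)) i"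
proof -
  have "N (d (e 0)) + bracket (e 0) (d (e 0)) = N (d (e 1)) + bracket (e 1) (d (e 0))"
    by (metis N_e0 d_bracket)
  \<comment> \<open>\<open>M (e 0)\<close> and \<open>M (e 1)\<close> differ only at
    \<open>e n\<close>, and \<open>Suc i\<close> stays below \<open>n\<close>.\<close>
  moreover have "coord (bracket (e 0) (d (e 0))) (Suc i) = coord (bracket (e 1) (d (e 0))) (Suc i)"
    if "1 \<le> i" "i \<le> n - 2" for i
    using that n_ge_3
    by (subst (1 2) coord_bracket) (auto simp: coord_N coord_M_e0 coord_M_basis coord_basis)
  ultimately have *: "coord (N (d (e 0))) (Suc i) = coord (N (d (e 1))) (Suc i)"
    if "1 \<le> i" "i \<le> n - 2" for i
    using that by (metis add_right_cancel coord_add)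
  show "coord (d (e 0)) 0 + coord (d (e 0)) 1 = coord (d (e 1)) 0 + coord (d (e 1)) 1"
    using *[of 1] n_ge_3 by (simp add: coord_N numeral_2_eq_2)
  show "2 \<le> i \<Longrightarrow> i \<le> n - 2 \<Longrightarrow> coord (d (e 0)) i = coord (d (e 1)) i"
    using *[of i] n_ge_3 by (auto simp: coord_N split: if_splits)
qed

text \<open>At \<open>e 2\<close>, the image under \<open>d\<close> of $[e_1, e_1]$ and the term
  $[d e_1, e_1]$ both vanish, while $[e_1, d e_1]$ contributes $b_0$.\<close>

lemma coord_d_e1_0 [unfolded One_nat_def]: "coord (d (e 1)) 0 = 0"
proof -
  have "M (e 1) \<in> F 3"
    using n_ge_3 by (intro M_e1_in_F) auto
  then have "coord (d (M (e 1))) 2 = 0"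
    using coord_d_F[of "M (e 1)" 2] F_mono[of 2 3] n_ge_3 by (auto simp: F_def)
  moreover have "coord (bracket (e 1) (d (e 1))) 2 = coord (d (e 1)) 0"
    using n_ge_3 by (subst coord_bracket) (simp add: coord_N_basis coord_M_basis)
  moreover have "coord (M (d (e 1))) 2 = 0"
    using n_ge_3 by (simp add: coord_M)
  ultimately show ?thesis
    by (simp add: d_bracket coord_add)
qed

text \<open>The Leibniz rule for $[f, e_1] = c e_n$, read at \<open>e n\<close>, says that
  \<open>eigenvalue n\<close> equals $a_0 + b_1$; by definition and $b_0 = 0$ it is $b_1 + (n - 1)
  a_0$.\<close>

lemma coord_d_e0_0:
  assumes "\<theta> \<noteq> \<alpha> n"
  shows "coord (d (e 0)) 0 = 0"
proof -
  interpret d: Vector_Spaces.linear scale scale d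
    by (rule linear_d)
  define f where "f = e 0 - e 1"
  define c where "c = \<theta> - \<alpha> n"
  define l where "l = coord (d (e 0)) 0"
  have c: "c \<noteq> 0"
    using assms by (simp add: c_def)
  have Mf [unfolded One_nat_def]: "M f = scale c (e n)"
  proof (rule coord_eqI)
    fix k assume "k \<le> n"
    then show "coord (M f) k = coord (scale c (e n)) k"
      using n_ge_3 unfolding f_def bracket_diff_left coord_diff
      by (auto simp: coord_M_e0 coord_M_basis coord_basis coord_scale c_def)
  qed
  have Nf: "N f = 0"
    by (simp only: f_def bracket_diff_left N_e0 diff_self)
  have df: "d f = d (e 0) - d (e 1)"
    by (simp add: f_def d.diff)
  have "coord (M (d f)) n = c * l"
  proof -
    \<comment> \<open>Coordinates 2 to \<open>n - 2\<close> of \<open>d f\<close> vanish, because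
      \<open>d (e 0)\<close> and \<open>d (e 1)\<close> agree there.\<close>
    have "(\<Sum>i = Suc 0..<n - Suc 0. \<alpha> (Suc n - i) * coord (d f) i) =
        (\<Sum>i \<in> {1}. \<alpha> (Suc n - i) * coord (d f) i)"
      using n_ge_3
      by (intro sum.mono_neutral_right) (auto simp: df coord_diff derivation_diff_coord)
    moreover have "coord (d f) 0 = l" "coord (d f) 1 = - l"
      using derivation_coeffs_relation coord_d_e1_0
      by (simp_all add: df coord_diff l_def algebra_simps)
    ultimately show ?thesis
      using n_ge_3 by (simp add: coord_M c_def algebra_simps)
  qed
  moreover have "coord (bracket f (d (e 1))) n = c * coord (d (e 1)) 1"
    using n_ge_3 by (subst coord_bracket) (simp add: Nf Mf coord_scale coord_basis coord_zero)
  moreover have "coord (d (M f)) n = c * eigenvalue n"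
    using n_ge_3 by (simp add: Mf d.scale coord_scale coord_d_basis)
  ultimately have "c * eigenvalue n = c * l + c * coord (d (e 1)) 1"
    by (simp add: d_bracket coord_add)
  then have "c * ((of_nat n - 2) * l) = 0"
    by (simp add: eigenvalue_def coord_d_e1_0 l_def algebra_simps)
  moreover have "of_nat n - 2 \<noteq> (0 :: complex)"
    using n_ge_3 of_nat_eq_iff[of n 2, where 'a = complex] by (auto simp del: of_nat_eq_iff)
  ultimately show ?thesis
    using c l_def by simp
qed

text \<open>At the first nonzero parameter, all three terms of the Leibniz rule for $[e_1, e_1]$
  have coordinate $b_1 \<alpha>_k$, so $b_1 \<alpha>_k = 2 b_1 \<alpha>_k$.\<close>

lemma coord_d_e1_1 [unfolded One_nat_def]:
  assumes "\<theta> \<noteq> \<alpha> n" "3 \<le> m" "m \<le> n" "\<alpha> m \<noteq> 0"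
  shows "coord (d (e 1)) 1 = 0"
proof -
  define k where "k = (LEAST k. 3 \<le> k \<and> \<alpha> k \<noteq> 0)"
  have k: "3 \<le> k" "\<alpha> k \<noteq> 0"
    using LeastI[of "\<lambda>k. 3 \<le> k \<and> \<alpha> k \<noteq> 0" m] assms by (auto simp: k_def)
  have kn: "k \<le> n"
    using Least_le[of "\<lambda>k. 3 \<le> k \<and> \<alpha> k \<noteq> 0" m] assms by (auto simp: k_def)
  have below: "\<alpha> i = 0" if "3 \<le> i" "i < k" for i
    using not_less_Least[of i "\<lambda>k. 3 \<le> k \<and> \<alpha> k \<noteq> 0"] that by (auto simp: k_def)
  define b where "b = coord (d (e 1)) 1"
  have "coord (d (M (e 1))) k = b * \<alpha> k"
    using coord_d_F[OF M_e1_in_F[OF k(1) kn below]] k kn assms n_ge_3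
    by (simp add: coord_M_basis eigenvalue_def coord_d_e1_0 coord_d_e0_0 b_def)
  moreover have "coord (bracket (e 1) (d (e 1))) k = b * \<alpha> k"
    using k kn n_ge_3
    by (subst coord_bracket) (simp add: coord_d_e1_0 coord_M_basis b_def)
  moreover have "coord (M (d (e 1))) k = b * \<alpha> k"
  proof -
    \<comment> \<open>For $2 <= i <= k - 2$ the parameter index $k + 1 - i$ lies between 3 and $k -
      1$, so minimality of \<open>k\<close> removes the term.\<close>
    have "(\<Sum>i = Suc 0..<k - Suc 0. \<alpha> (Suc k - i) * coord (d (e 1)) i) =
        (\<Sum>i \<in> {1}. \<alpha> (Suc k - i) * coord (d (e 1)) i)"
      using k by (intro sum.mono_neutral_right) (auto simp: below)
    then show ?thesis
      using kn by (simp add: coord_M coord_d_e1_0 b_def)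
  qed
  ultimately show ?thesis
    using k by (simp add: d_bracket coord_add b_def)
qed

text \<open>All eigenvalues are now zero, so \<open>d\<close> is strictly triangular and maps
  \<open>F j\<close> into \<open>F (Suc j)\<close>; after \<open>Suc n\<close> steps only zero is
  left.\<close>

lemma derivation_nilpotent:
  assumes "\<theta> \<noteq> \<alpha> n" "3 \<le> m" "m \<le> n" "\<alpha> m \<noteq> 0"
  shows "d ^^ Suc n = (\<lambda>_. 0)"
proof -
  have zero: "coord (d (e 0)) 0 = 0" "coord (d (e 1)) 0 = 0" "coord (d (e 1)) 1 = 0"
    using assms by (simp_all add: coord_d_e0_0 coord_d_e1_0 coord_d_e1_1)
  then have zero': "coord (d (e 0)) 1 = 0"
    using derivation_coeffs_relation by simp
  have basis: "coord (d (e i)) k = 0" if "k \<le> i" "i \<le> n" for i k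
  proof -
    consider "i = 0" | "i = 1" | "2 \<le> i" by linarith
    then show ?thesis
      using that zero zero' by cases (auto simp: coord_d_basis eigenvalue_def le_Suc_eq)
  qed
  have step: "d x \<in> F (Suc j)" if "x \<in> F j" for x j
  proof -
    have "coord (d x) k = 0" if "k < Suc j" for k
    proof -
      have "coord x i * coord (d (e i)) k = 0" if "i \<le> n" for i
        using \<open>x \<in> F j\<close> \<open>k < Suc j\<close> \<open>i \<le> n\<close> basis[of k i] by (cases "i < j") (auto simp: F_def)
      then show ?thesis
        unfolding coord_d[of x] by (intro sum.neutral) auto
    qed
    then show ?thesis
      by (simp add: F_def)
  qed
  have "(d ^^ j) x \<in> F j" for j x
    by (induction j) (simp_all add: step, simp add: F_def)
  then show ?thesis
    using F_eq_zero by blast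
qed

end

end

theorem theorem3p2:
  fixes scale :: "complex \<Rightarrow> 'a::ab_group_add \<Rightarrow> 'a"
    and bracket :: "'a \<Rightarrow> 'a \<Rightarrow> 'a"
    and e :: "nat \<Rightarrow> 'a"
    and n :: nat
    and \<alpha> :: "nat \<Rightarrow> complex"
    and \<theta> :: complex
  assumes "n \<ge> 3"
    and "F1_algebra scale bracket e n \<alpha> \<theta>"
    and "\<theta> \<noteq> \<alpha> n"
    and "\<exists>k. 3 \<le> k \<and> k \<le> n \<and> \<alpha> k \<noteq> 0"
  shows "characteristically_nilpotent scale bracket"
proof -
  interpret F1_algebra_ge3 scale bracket e n \<alpha> \<theta>
    using assms by (simp add: F1_algebra_ge3_def F1_algebra_ge3_axioms_def)
  show ?thesis
    using assms leibniz_algebra nilpotent derivation_nilpotent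
    unfolding characteristically_nilpotent_def by blast
qed

end
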